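(* Let $(U,\mathcal{L})$ be an oriented matroid of rank $d$ and let $G$ be its tope graph (which is of VC-dimension $d$). Then $G$ can be completed to an ample partial cube $\mathrm{amp}(G)$ of VC-dimension $d$; that is, there exists an ample family $\mathcal{S}\subseteq\{-1,+1\}^U$ of VC-dimension $d$ that contains all topes of $\mathcal{L}$.
   Context: $U$ is a finite set with $m$ elements. A system of sign vectors is a pair $(U,\mathcal{L})$ with $\mathcal{L}\subseteq\{-1,0,+1\}^U$; its elements are called covectors. For sign vectors $X,Y$: the separator is $S(X,Y)=\{e\in U: X_eY_e=-1\}$; the composition $X\circ Y$ is given by $(X\circ Y)_e=X_e$ if $X_e\neq 0$ and $(X\circ Y)_e=Y_e$ if $X_e=0$; and $\le$ is the product order on $\{-1,0,+1\}^U$ induced by $0\le -1$, $0\le +1$ (with $-1,+1$ incomparable). An oriented matroid (OM) is a system of sign vectors $(U,\mathcal{L})$ satisfying: (C) $X\circ Y\in\mathcal{L}$ for all $X,Y\in\mathcal{L}$; (SE) for all $X,Y\in\mathcal{L}$ and each $e\in S(X,Y)$ there is $Z\in\mathcal{L}$ with $Z_e=0$ and $Z_f=(X\circ Y)_f$ for all $f\in U\setminus S(X,Y)$; (Sym) $-\mathcal{L}=\mathcal{L}$. Throughout, all systems are assumed simple: for each $e\in U$, $\{X_e:X\in\mathcal{L}\}=\{-1,0,+1\}$, and for each pair $e\neq f$ in $U$ there exist $X,Y\in\mathcal{L}$ with $\{X_eX_f,Y_eY_f\}=\{+1,-1\}$. The poset $(\mathcal{L},\le)$ together with an artificial global maximum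 $\hat 1$ is a graded lattice; the rank of $\mathcal{L}$ is the length (number of elements minus one) of its maximal chains minus one. The topes are the co-atoms of this lattice; for simple OMs they are exactly the covectors in $\{-1,+1\}^U$. The tope graph of $\mathcal{L}$ is the subgraph of the hypercube $Q(U)$ on $\{-1,+1\}^U$ (edges: vectors differing in exactly one coordinate) induced by the topes. Vectors in $\{-1,+1\}^U$ are identified with subsets of $U$ (the set of coordinates equal to $+1$), so a set of vertices of the hypercube is a family $\mathcal{S}\subseteq 2^U$. A set $X\subseteq U$ is shattered by $\mathcal{S}$ if for every $Y\subseteq X$ there is $S\in\mathcal{S}$ with $S\cap X=Y$. The VC-dimension of $\mathcal{S}$ (and of the subgraph of $Q(U)$ induced by $\mathcal{S}$) is the largest size of a shattered set. $X$ is strongly shattered by $\mathcal{S}$ if there is $Y\subseteq U\setminus X$ with $\{Y\cup X':X'\subseteq X\}\subseteq\mathcal{S}$. $\mathcal{S}$ is ample if every set shattered by $\mathcal{S}$ is strongly shattered by $\mathcal{S}$ (equivalently, $|\mathcal{S}|$ equals the number of sets shattered by $\mathcal{S}$). The subgraph of $Q(U)$ induced by a (nonempty) ample family is an isometric subgraph of $Q(U)$ and is called an ample partial cube. *)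

theory Defs
  imports Main
begin

section \<open>Sign vectors\<close>

text \<open>
  The set \<open>{-1,0,+1}\<^sup>U\<close> consists of integer-valued functions.  They are normalised to be 0
  outside \<open>U\<close>, so that equality of functions is equality of sign vectors on \<open>U\<close>, and
  negation and composition preserve the normalisation.
\<close>

definition sign_vectors :: "'a set \<Rightarrow> ('a \<Rightarrow> int) set" where
  "sign_vectors U = {X. (\<forall>e\<in>U. X e \<in> {-1, 0, 1}) \<and> (\<forall>e. e \<notin> U \<longrightarrow> X e = 0)}"

definition separator :: "'a set \<Rightarrow> ('a \<Rightarrow> int) \<Rightarrow> ('a \<Rightarrow> int) \<Rightarrow> 'a set" where
  "separator U X Y = {e \<in> U. X e * Y e = -1}"

definition sv_comp :: "('a \<Rightarrow> int) \<Rightarrow> ('a \<Rightarrow> int) \<Rightarrow> ('a \<Rightarrow> int)" where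
  "sv_comp X Y = (\<lambda>e. if X e \<noteq> 0 then X e else Y e)"

definition sign_le :: "int \<Rightarrow> int \<Rightarrow> bool" where
  "sign_le a b \<longleftrightarrow> a = b \<or> (a = 0 \<and> b \<in> {-1, 1})"

definition sv_le :: "'a set \<Rightarrow> ('a \<Rightarrow> int) \<Rightarrow> ('a \<Rightarrow> int) \<Rightarrow> bool" where
  "sv_le U X Y \<longleftrightarrow> (\<forall>e\<in>U. sign_le (X e) (Y e))"


section \<open>Oriented matroids\<close>

locale sign_system =
  fixes U :: "'a set" and L :: "('a \<Rightarrow> int) set"
  assumes finite_ground: "finite U"
    and covectors: "L \<subseteq> sign_vectors U"

locale oriented_matroid = sign_system +
  assumes C: "\<lbrakk>X \<in> L; Y \<in> L\<rbrakk> \<Longrightarrow> sv_comp X Y \<in> L"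
    and SE: "\<lbrakk>X \<in> L; Y \<in> L; e \<in> separator U X Y\<rbrakk> \<Longrightarrow>
      \<exists>Z\<in>L. Z e = 0 \<and> (\<forall>f \<in> U - separator U X Y. Z f = sv_comp X Y f)"
    and Sym: "(\<lambda>X e. - X e) ` L = L"

locale simple_oriented_matroid = oriented_matroid +
  assumes simple_element: "e \<in> U \<Longrightarrow> (\<lambda>X. X e) ` L = {-1, 0, 1}"
    and simple_pair: "\<lbrakk>e \<in> U; f \<in> U; e \<noteq> f\<rbrakk> \<Longrightarrow>
      \<exists>X\<in>L. \<exists>Y\<in>L. {X e * X f, Y e * Y f} = {1, -1}"


section \<open>Rank and topes\<close>

text \<open>
  The covectors together with an artificial maximum: \<open>Some X\<close> stands for the covector \<open>X\<close>,
  \<open>None\<close> for the added maximum.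
\<close>

definition face_lattice :: "('a \<Rightarrow> int) set \<Rightarrow> ('a \<Rightarrow> int) option set" where
  "face_lattice L = insert None (Some ` L)"

fun face_le :: "'a set \<Rightarrow> ('a \<Rightarrow> int) option \<Rightarrow> ('a \<Rightarrow> int) option \<Rightarrow> bool" where
  "face_le U x None = True"
| "face_le U None (Some Y) = False"
| "face_le U (Some X) (Some Y) = sv_le U X Y"

text \<open>
  For oriented matroids all maximal chains have the same length, so the maximum below is their
  common length; for an arbitrary system it is the length of a longest chain.  The rank is an
  integer because the empty system has rank \<open>-1\<close>.
\<close>

definition om_rank :: "'a set \<Rightarrow> ('a \<Rightarrow> int) set \<Rightarrow> int" where
  "om_rank U L =
    Max {int (card C) - 1 | C. pred_on.maxchain (face_lattice L) (face_le U) C} - 1"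

text \<open>The topes are the co-atoms.\<close>

definition topes :: "'a set \<Rightarrow> ('a \<Rightarrow> int) set \<Rightarrow> ('a \<Rightarrow> int) set" where
  "topes U L = {X \<in> L. \<forall>y \<in> face_lattice L. face_le U (Some X) y \<longrightarrow> y = Some X \<or> y = None}"

text \<open>The identification of \<open>{-1,+1}\<^sup>U\<close> with the power set of \<open>U\<close>.\<close>

definition pos_set :: "'a set \<Rightarrow> ('a \<Rightarrow> int) \<Rightarrow> 'a set" where
  "pos_set U X = {e \<in> U. X e = 1}"

text \<open>
  An induced subgraph of the hypercube is determined by its vertex set, and is
  represented by it; this is the vertex set of the tope graph.
\<close>

definition tope_family :: "'a set \<Rightarrow> ('a \<Rightarrow> int) set \<Rightarrow> 'a set set" where
  "tope_family U L = pos_set U ` topes U L"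


section \<open>Shattering and ampleness\<close>

definition shatters :: "'a set set \<Rightarrow> 'a set \<Rightarrow> bool" where
  "shatters F X \<longleftrightarrow> (\<forall>Y. Y \<subseteq> X \<longrightarrow> (\<exists>S\<in>F. S \<inter> X = Y))"

definition strongly_shatters :: "'a set \<Rightarrow> 'a set set \<Rightarrow> 'a set \<Rightarrow> bool" where
  "strongly_shatters U F X \<longleftrightarrow> (\<exists>Y. Y \<subseteq> U - X \<and> {Y \<union> X' | X'. X' \<subseteq> X} \<subseteq> F)"

text \<open>Only meaningful for a nonempty family: the empty family does not even shatter \<open>{}\<close>.\<close>

definition vc_dim :: "'a set \<Rightarrow> 'a set set \<Rightarrow> nat" where
  "vc_dim U F = Max {card X | X. X \<subseteq> U \<and> shatters F X}"

definition ample :: "'a set \<Rightarrow> 'a set set \<Rightarrow> bool" where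
  "ample U F \<longleftrightarrow> F \<subseteq> Pow U \<and> (\<forall>X. X \<subseteq> U \<and> shatters F X \<longrightarrow> strongly_shatters U F X)"

end

theory Submission
  imports Defs
begin

text \<open>
  Suppose that the covectors are those of a central arrangement of
  hyperplanes \<open>v\<^sub>e \<bullet> x = 0\<close>.  Translate the hyperplanes to \<open>v\<^sub>e \<bullet> x = c\<^sub>e\<close> for generic \<open>c\<close>.  Far
  from the origin nothing changes, so every central region survives.  In the translated
  arrangement a set of hyperplanes has a common point only if its normals are independent, and
  then the hyperplanes cross in a full cube of regions: the sign vectors of the regions form an
  ample family whose shattered sets are the independent sets.  For \<open>c\<^sub>e\<close> positive and rapidly
  decreasing along a linear order \<open>r\<close> of \<open>U\<close>, linear programming duality describes the
  regions in terms of covectors alone: \<open>T\<close> is a region iff each \<open>i\<close> with \<open>T\<^sub>i = +\<close> has a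
  covector which is \<open>+\<close> at \<open>i\<close> and conforms to \<open>T\<close> at \<open>i\<close> and everything after it.  This
  condition makes sense in every oriented matroid; it defines the family
  \<open>generic_translation\<close>, which is the completion.

  The role of independence is played by \<open>free_on L B\<close>: every pattern of
  nonzero signs on \<open>B\<close> extends to a covector.  Three facts carry the proof.

  \<^item> A set shattered by the generic translation is free: the covectors from the definition can
    be composed in increasing order to produce any sign pattern
    (\<open>free_on_if_generic_translation_shatters\<close>).

  \<^item> A free set is strongly shattered by it: composing the covectors that are dual to the
    elements of \<open>B\<close> in increasing order yields a point of the translated arrangement around
    which all patterns on \<open>B\<close> occur (\<open>generic_translation_strongly_shatters\<close>).

  \<^item> The rank is the largest size of a free set: a chain of covectors gains a new
    support element in each step, and those elements form a free set; conversely the dual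
    covectors of a free set compose to a chain (\<open>om_rank_eq_vc_dim\<close>).

  Topes are covectors, hence belong to the generic translation, and they shatter exactly the
  free sets.  So both families have the rank as their VC-dimension.
\<close>

section \<open>Free sets and covectors\<close>

definition pattern_sign :: "'a set \<Rightarrow> 'a \<Rightarrow> int" where
  "pattern_sign P b = (if b \<in> P then 1 else -1)"

text \<open>
  For oriented matroids these are the independent sets of the underlying matroid, described
  without reference to circuits.
\<close>

definition free_on :: "('a \<Rightarrow> int) set \<Rightarrow> 'a set \<Rightarrow> bool" where
  "free_on L B \<longleftrightarrow> (\<forall>P\<subseteq>B. \<exists>Y\<in>L. \<forall>b\<in>B. Y b = pattern_sign P b)"

context oriented_matroid
begin

lemma covector_value: "X \<in> L \<Longrightarrow> X e = -1 \<or> X e = 0 \<or> X e = 1"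
  using covectors unfolding sign_vectors_def by (cases "e \<in> U") auto

lemma covector_outside: "X \<in> L \<Longrightarrow> e \<notin> U \<Longrightarrow> X e = 0"
  using covectors unfolding sign_vectors_def by auto

lemma uminus_covector: "X \<in> L \<Longrightarrow> (\<lambda>e. - X e) \<in> L"
  using Sym by blast

lemma finite_covectors: "finite L"
proof (rule finite_subset[OF covectors])
  have "sign_vectors U = {X. \<forall>e. (e \<in> U \<longrightarrow> X e \<in> {-1, 0, 1}) \<and> (e \<notin> U \<longrightarrow> X e = 0)}"
    unfolding sign_vectors_def by blast
  then show "finite (sign_vectors U)"
    using finite_set_of_finite_funs[OF finite_ground, of "{-1, 0, 1::int}" 0] by simp
qed

text \<open>
  Eliminating an element between a covector and its negative creates a zero there and keeps all
  zeros, so the ground set can be cleared one element at a time.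
\<close>

lemma zero_covector:
  assumes "L \<noteq> {}"
  shows "(\<lambda>_. 0) \<in> L"
proof -
  have "\<exists>X\<in>L. \<forall>e\<in>Z. X e = 0" if "finite Z" "Z \<subseteq> U" for Z
    using that
  proof (induction Z)
    case empty
    then show ?case using assms by auto
  next
    case (insert z Z)
    then obtain X where X: "X \<in> L" "\<forall>e\<in>Z. X e = 0" by auto
    show ?case
    proof (cases "X z = 0")
      case True
      then show ?thesis using X by auto
    next
      case False
      then have "z \<in> separator U X (\<lambda>e. - X e)"
        using covector_value[OF X(1), of z] insert.prems unfolding separator_def by auto
      from SE[OF X(1) uminus_covector[OF X(1)] this]
      obtain W where W: "W \<in> L" "W z = 0"
        "\<forall>f\<in>U - separator U X (\<lambda>e. - X e). W f = sv_comp X (\<lambda>e. - X e) f" by auto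
      have "W e = 0" if "e \<in> Z" for e
      proof -
        have "e \<in> U - separator U X (\<lambda>e. - X e)"
          using that X(2) insert.prems unfolding separator_def by auto
        then show ?thesis using W(3) X(2) that unfolding sv_comp_def by auto
      qed
      then show ?thesis using W(1,2) by auto
    qed
  qed
  from this[OF finite_ground order_refl]
  obtain X where X: "X \<in> L" "\<forall>e\<in>U. X e = 0" by blast
  then have "X = (\<lambda>_. 0)" using covector_outside by (intro ext) blast
  then show ?thesis using X by simp
qed

text \<open>
  Two covectors that differ on \<open>B\<close> only by opposite signs at \<open>z\<close> have a common value
  everywhere else on \<open>B\<close>, and elimination of \<open>z\<close> preserves it.  Hence on a free set all sign
  vectors occur, also those with zeros.
\<close>

lemma free_on_with_zeros:
  assumes "free_on L B" "B \<subseteq> U" "Z \<subseteq> B"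
  shows "\<exists>Y\<in>L. \<forall>b\<in>B. Y b = (if b \<in> Z then 0 else pattern_sign P b)"
proof -
  have "finite Z" using assms finite_ground finite_subset by metis
  then show ?thesis
    using \<open>Z \<subseteq> B\<close>
  proof (induction Z arbitrary: P)
    case empty
    have "P \<inter> B \<subseteq> B" by simp
    then obtain Y where "Y \<in> L" "\<forall>b\<in>B. Y b = pattern_sign (P \<inter> B) b"
      using assms(1) unfolding free_on_def by blast
    then show ?case by (intro bexI[of _ Y]) (auto simp: pattern_sign_def)
  next
    case (insert z Z)
    then have "z \<in> B" "Z \<subseteq> B" by auto
    obtain Y1 where Y1: "Y1 \<in> L"
      "\<forall>b\<in>B. Y1 b = (if b \<in> Z then 0 else pattern_sign (P \<union> {z}) b)"
      using insert.IH[OF \<open>Z \<subseteq> B\<close>] by blast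
    obtain Y2 where Y2: "Y2 \<in> L"
      "\<forall>b\<in>B. Y2 b = (if b \<in> Z then 0 else pattern_sign (P - {z}) b)"
      using insert.IH[OF \<open>Z \<subseteq> B\<close>] by blast
    have "z \<in> separator U Y1 Y2"
      using \<open>z \<in> B\<close> Y1(2) Y2(2) insert.hyps assms(2)
      by (auto simp: separator_def pattern_sign_def)
    from SE[OF Y1(1) Y2(1) this] obtain W where W: "W \<in> L" "W z = 0"
      "\<forall>f\<in>U - separator U Y1 Y2. W f = sv_comp Y1 Y2 f" by auto
    have "W b = (if b \<in> insert z Z then 0 else pattern_sign P b)" if "b \<in> B" for b
    proof (cases "b = z")
      case True
      then show ?thesis using W(2) by simp
    next
      case False
      then have eq: "Y1 b = (if b \<in> Z then 0 else pattern_sign P b)" "Y2 b = Y1 b"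
        using Y1(2) Y2(2) that by (auto simp: pattern_sign_def)
      then have "b \<in> U - separator U Y1 Y2"
        using that assms(2) by (auto simp: separator_def pattern_sign_def)
      then show ?thesis using W(3) eq False by (auto simp: sv_comp_def)
    qed
    then show ?case using W(1) by blast
  qed
qed

text \<open>The fundamental cocircuits of a basis are of this kind.\<close>

lemma free_on_dual_covector:
  assumes "free_on L B" "B \<subseteq> U" "b \<in> B"
  shows "\<exists>Y\<in>L. \<forall>b'\<in>B. Y b' = (if b' = b then 1 else 0)"
proof -
  obtain Y where "Y \<in> L" "\<forall>b'\<in>B. Y b' = (if b' \<in> B - {b} then 0 else pattern_sign {b} b')"
    using free_on_with_zeros[OF assms(1,2), of "B - {b}" "{b}"] by blast
  then show ?thesis by (intro bexI[of _ Y]) (auto simp: pattern_sign_def)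
qed

end

section \<open>The generic translation\<close>

definition generic_translation ::
    "'a set \<Rightarrow> ('a \<Rightarrow> int) set \<Rightarrow> ('a \<Rightarrow> nat) \<Rightarrow> 'a set set" where
  "generic_translation U L r =
    {T. T \<subseteq> U \<and> (\<forall>i\<in>T. \<exists>X\<in>L. X i = 1 \<and>
      (\<forall>j\<in>U. r i \<le> r j \<longrightarrow> (X j = 1 \<longrightarrow> j \<in> T) \<and> (X j = -1 \<longrightarrow> j \<notin> T)))}"

context oriented_matroid
begin

lemma pos_set_in_generic_translation: "X \<in> L \<Longrightarrow> pos_set U X \<in> generic_translation U L r"
  unfolding generic_translation_def pos_set_def by fastforce

text \<open>
  To realize a pattern \<open>P\<close>, take for each \<open>i\<close> a covector that is right at \<open>i\<close> and conforms
  to \<open>P\<close> from \<open>i\<close> on; for a negative \<open>i\<close> it is the negative of one obtained from the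
  complementary pattern.  In a composition in increasing order the uncontrolled entries of
  the covector for \<open>i\<close>, which lie before \<open>i\<close>, are overridden by earlier factors.
\<close>

lemma free_on_if_generic_translation_shatters:
  assumes ne: "L \<noteq> {}" and inj: "inj_on r U" and B: "B \<subseteq> U"
    and sh: "shatters (generic_translation U L r) B"
  shows "free_on L B"
  unfolding free_on_def
proof (intro allI impI)
  fix P assume P: "P \<subseteq> B"
  let ?s = "pattern_sign P"
  have step: "\<exists>Y\<in>L. Y i = ?s i \<and> (\<forall>j\<in>B. r i \<le> r j \<longrightarrow> Y j \<in> {0, ?s j})"
    if i: "i \<in> B" for i
  proof (cases "i \<in> P")
    case True
    obtain T where T: "T \<in> generic_translation U L r" "T \<inter> B = P"
      using sh P unfolding shatters_def by blast
    then obtain X where X: "X \<in> L" "X i = 1"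
      "\<forall>j\<in>U. r i \<le> r j \<longrightarrow> (X j = 1 \<longrightarrow> j \<in> T) \<and> (X j = -1 \<longrightarrow> j \<notin> T)"
      using True unfolding generic_translation_def by blast
    have "X j \<in> {0, ?s j}" if "j \<in> B" "r i \<le> r j" for j
      using X(3) T(2) B that covector_value[OF X(1), of j] by (auto simp: pattern_sign_def)
    then show ?thesis using X(1,2) True by (intro bexI[of _ X]) (auto simp: pattern_sign_def)
  next
    case False
    have "B - P \<subseteq> B" by blast
    then obtain T where T: "T \<in> generic_translation U L r" "T \<inter> B = B - P"
      using sh unfolding shatters_def by blast
    then have "i \<in> T" using i False by blast
    then obtain X where X: "X \<in> L" "X i = 1"
      "\<forall>j\<in>U. r i \<le> r j \<longrightarrow> (X j = 1 \<longrightarrow> j \<in> T) \<and> (X j = -1 \<longrightarrow> j \<notin> T)"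
      using T(1) unfolding generic_translation_def by blast
    have "- X j \<in> {0, ?s j}" if "j \<in> B" "r i \<le> r j" for j
      using X(3) T(2) B that covector_value[OF X(1), of j] by (auto simp: pattern_sign_def)
    then show ?thesis
      using uminus_covector[OF X(1)] X(2) False
      by (intro bexI[of _ "\<lambda>e. - X e"]) (auto simp: pattern_sign_def)
  qed
  have "\<exists>Z\<in>L. \<forall>j\<in>B. (r j < n \<longrightarrow> Z j = ?s j) \<and> Z j \<in> {0, ?s j}" for n
  proof (induction n)
    case 0
    show ?case using zero_covector[OF ne] by (intro bexI[of _ "\<lambda>_. 0"]) auto
  next
    case (Suc n)
    then obtain Z where Z: "Z \<in> L"
      "\<forall>j\<in>B. (r j < n \<longrightarrow> Z j = ?s j) \<and> Z j \<in> {0, ?s j}" by blast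
    show ?case
    proof (cases "\<exists>i\<in>B. r i = n")
      case True
      then obtain i where i: "i \<in> B" "r i = n" by blast
      obtain Y where Y: "Y \<in> L" "Y i = ?s i" "\<forall>j\<in>B. r i \<le> r j \<longrightarrow> Y j \<in> {0, ?s j}"
        using step[OF i(1)] by blast
      have "(r j < Suc n \<longrightarrow> sv_comp Z Y j = ?s j) \<and> sv_comp Z Y j \<in> {0, ?s j}"
        if j: "j \<in> B" for j
      proof -
        consider "r j < n" | "j = i" | "r i \<le> r j" "\<not> r j < Suc n"
          using inj B i j unfolding inj_on_def by (metis less_SucE not_less subsetD)
        then show ?thesis
        proof cases
          case 1
          moreover from this have "Z j = ?s j" using Z(2) j by blast
          moreover have "?s j \<noteq> 0" by (simp add: pattern_sign_def)
          ultimately show ?thesis by (simp add: sv_comp_def)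
        next
          case 2
          then show ?thesis using Z(2) i Y(2) by (auto simp: sv_comp_def)
        next
          case 3
          then have "Y j \<in> {0, ?s j}" "Z j \<in> {0, ?s j}" using Y(3) Z(2) j by blast+
          then show ?thesis using 3(2) by (auto simp: sv_comp_def)
        qed
      qed
      then show ?thesis using C[OF Z(1) Y(1)] by blast
    next
      case False
      then have "r j < Suc n \<longleftrightarrow> r j < n" if "j \<in> B" for j
        using that by (auto simp: less_Suc_eq)
      then show ?thesis using Z by blast
    qed
  qed
  note ex = this
  have "finite B" using B finite_ground finite_subset by blast
  then obtain n where n: "\<forall>j\<in>B. r j < n"
    using finite_nat_set_iff_bounded[of "r ` B"] by auto
  show "\<exists>Y\<in>L. \<forall>b\<in>B. Y b = ?s b" using ex[of n] n by blast
qed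

text \<open>
  The positions of the elements outside \<open>B\<close> are read off from compositions of dual covectors:
  in the geometric picture the sum of the dual vectors, weighted by \<open>c\<close>, is a point where the
  translated hyperplanes of \<open>B\<close> meet.  Its side of a further hyperplane \<open>e\<close> is decided by the
  dominant summands, those of the elements of \<open>B\<close> before \<open>e\<close>; it is the negative side if
  they all vanish at \<open>e\<close>, as \<open>c\<^sub>e\<close> then outweighs the remaining ones.
\<close>

lemma generic_translation_strongly_shatters:
  assumes ne: "L \<noteq> {}" and inj: "inj_on r U" and B: "B \<subseteq> U" and free: "free_on L B"
  shows "strongly_shatters U (generic_translation U L r) B"
proof -
  have "\<forall>b\<in>B. \<exists>Y. Y \<in> L \<and> (\<forall>b'\<in>B. Y b' = (if b' = b then 1 else 0))"
    using free_on_dual_covector[OF free B] by blast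
  from bchoice[OF this]
  obtain D where D: "\<And>b. b \<in> B \<Longrightarrow> D b \<in> L"
    "\<And>b b'. b \<in> B \<Longrightarrow> b' \<in> B \<Longrightarrow> D b b' = (if b' = b then 1 else 0)"
    by blast
  \<comment> \<open>\<open>Z n\<close> is the composition, in increasing order, of the dual covectors \<open>D b\<close> with \<open>r b < n\<close>.\<close>
  define Z where "Z = rec_nat (\<lambda>_. 0)
    (\<lambda>n X. if \<exists>b\<in>B. r b = n then sv_comp X (D (SOME b. b \<in> B \<and> r b = n)) else X)"
  have Z0: "Z 0 = (\<lambda>_. 0)" by (simp add: Z_def)
  have Z_hit: "Z (Suc (r b)) = sv_comp (Z (r b)) (D b)" if "b \<in> B" for b
  proof -
    have "(SOME b'. b' \<in> B \<and> r b' = r b) = b"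
      using that inj B unfolding inj_on_def by (intro some_equality) auto
    then show ?thesis using that by (auto simp: Z_def)
  qed
  have Z_miss: "Z (Suc n) = Z n" if "\<not> (\<exists>b\<in>B. r b = n)" for n
    using that by (simp add: Z_def)
  have Z_L: "Z n \<in> L" for n
  proof (induction n)
    case 0
    show ?case using zero_covector[OF ne] Z0 by simp
  next
    case (Suc n)
    then show ?case using C D(1) Z_hit Z_miss by metis
  qed
  have Z_stable: "Z n e = Z m e" if "m \<le> n" "Z m e \<noteq> 0" for m n e
    using that
  proof (induction n rule: dec_induct)
    case base
    show ?case by simp
  next
    case (step n)
    show ?case
    proof (cases "\<exists>b\<in>B. r b = n")
      case True
      then obtain b where "b \<in> B" "r b = n" by blast
      then show ?thesis using Z_hit[of b] step by (simp add: sv_comp_def)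
    next
      case False
      then show ?thesis using Z_miss step by simp
    qed
  qed
  have Z_B: "Z n b = (if r b < n then 1 else 0)" if "b \<in> B" for n b
  proof (induction n)
    case 0
    show ?case by (simp add: Z0)
  next
    case (Suc n)
    show ?case
    proof (cases "\<exists>b\<in>B. r b = n")
      case True
      then obtain c where c: "c \<in> B" "r c = n" by blast
      have "b = c \<longleftrightarrow> r b = n" using c that inj B unfolding inj_on_def by auto
      then show ?thesis using Z_hit[OF c(1)] c Suc D(2)[OF c(1) that]
        by (auto simp: sv_comp_def less_Suc_eq)
    next
      case False
      then have "r b \<noteq> n" using that by blast
      then show ?thesis using Z_miss[OF False] Suc by (simp add: less_Suc_eq)
    qed
  qed
  define Y where "Y = {e \<in> U - B. Z (r e) e = 1}"
  have "Y \<union> X' \<in> generic_translation U L r" if X': "X' \<subseteq> B" for X'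
  proof -
    have conf: "(Z n j = 1 \<longrightarrow> j \<in> Y \<union> X') \<and> (Z n j = -1 \<longrightarrow> j \<notin> Y \<union> X')"
      if "j \<in> U" "j \<notin> B" "n \<le> r j" for j n
      using Z_stable[OF that(3), of j] that(1,2) X' by (auto simp: Y_def)
    have "\<exists>X\<in>L. X i = 1 \<and> (\<forall>j\<in>U. r i \<le> r j \<longrightarrow>
        (X j = 1 \<longrightarrow> j \<in> Y \<union> X') \<and> (X j = -1 \<longrightarrow> j \<notin> Y \<union> X'))"
      if i: "i \<in> Y \<union> X'" for i
    proof (cases "i \<in> B")
      case True
      have "(Z (Suc (r i)) j = 1 \<longrightarrow> j \<in> Y \<union> X') \<and> (Z (Suc (r i)) j = -1 \<longrightarrow> j \<notin> Y \<union> X')"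
        if j: "j \<in> U" "r i \<le> r j" for j
      proof (cases "j = i")
        case True
        then show ?thesis using i Z_B[OF \<open>i \<in> B\<close>] by simp
      next
        case False
        then have "Suc (r i) \<le> r j"
          using j True B inj unfolding inj_on_def by (metis Suc_leI le_neq_implies_less subsetD)
        then show ?thesis using conf[OF j(1)] Z_B[of j] by (cases "j \<in> B") auto
      qed
      then show ?thesis using Z_L Z_B[OF True] by (intro bexI[of _ "Z (Suc (r i))"]) auto
    next
      case False
      then have "Z (r i) i = 1" using i X' by (auto simp: Y_def)
      moreover have "(Z (r i) j = 1 \<longrightarrow> j \<in> Y \<union> X') \<and> (Z (r i) j = -1 \<longrightarrow> j \<notin> Y \<union> X')"
        if j: "j \<in> U" "r i \<le> r j" for j
        using conf[OF j(1) _ j(2)] Z_B[of j] j(2) by (cases "j \<in> B") auto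
      ultimately show ?thesis using Z_L by blast
    qed
    then show ?thesis using X' B unfolding generic_translation_def Y_def by blast
  qed
  moreover have "Y \<subseteq> U - B" by (auto simp: Y_def)
  ultimately show ?thesis unfolding strongly_shatters_def by blast
qed

lemma generic_translation_shatters_iff:
  assumes "L \<noteq> {}" "inj_on r U" "B \<subseteq> U"
  shows "shatters (generic_translation U L r) B \<longleftrightarrow> free_on L B"
proof
  assume "free_on L B"
  then obtain Y where Y: "Y \<subseteq> U - B" "{Y \<union> X' | X'. X' \<subseteq> B} \<subseteq> generic_translation U L r"
    using generic_translation_strongly_shatters[OF assms] unfolding strongly_shatters_def by blast
  show "shatters (generic_translation U L r) B"
    unfolding shatters_def
  proof (intro allI impI)
    fix P assume "P \<subseteq> B"
    then have "Y \<union> P \<in> generic_translation U L r" "(Y \<union> P) \<inter> B = P" using Y by blast+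
    then show "\<exists>S\<in>generic_translation U L r. S \<inter> B = P" by blast
  qed
qed (use assms free_on_if_generic_translation_shatters in blast)

lemma ample_generic_translation:
  assumes "L \<noteq> {}" "inj_on r U"
  shows "ample U (generic_translation U L r)"
  unfolding ample_def
proof (intro conjI allI impI)
  show "generic_translation U L r \<subseteq> Pow U" unfolding generic_translation_def by blast
next
  fix X assume "X \<subseteq> U \<and> shatters (generic_translation U L r) X"
  then show "strongly_shatters U (generic_translation U L r) X"
    using generic_translation_shatters_iff generic_translation_strongly_shatters assms by blast
qed

end

section \<open>Topes\<close>

context simple_oriented_matroid
begin

lemma full_support_covector:
  assumes "L \<noteq> {}"
  shows "\<exists>W\<in>L. \<forall>e\<in>U. W e \<noteq> 0"
proof -
  have "\<exists>W\<in>L. \<forall>e\<in>A. W e \<noteq> 0" if "finite A" "A \<subseteq> U" for A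
    using that
  proof (induction A)
    case empty
    then show ?case using assms by auto
  next
    case (insert a A)
    then obtain W where W: "W \<in> L" "\<forall>e\<in>A. W e \<noteq> 0" by auto
    have "1 \<in> (\<lambda>X. X a) ` L" using simple_element[of a] insert.prems by auto
    then obtain X where "X \<in> L" "X a = 1" by auto
    then show ?case using C[OF W(1), of X] W(2)
      by (intro bexI[of _ "sv_comp W X"]) (auto simp: sv_comp_def)
  qed
  then show ?thesis using finite_ground by blast
qed

lemma full_support_imp_tope:
  assumes "X \<in> L" "\<forall>e\<in>U. X e \<noteq> 0"
  shows "X \<in> topes U L"
proof -
  have "Y = X" if "Y \<in> L" "sv_le U X Y" for Y
  proof
    fix e
    show "Y e = X e"
      using that assms covector_outside[of X e] covector_outside[of Y e]
      by (cases "e \<in> U") (auto simp: sv_le_def sign_le_def)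
  qed
  then show ?thesis using assms(1) by (auto simp: topes_def face_lattice_def)
qed

lemma tope_full_support:
  assumes X: "X \<in> topes U L" and "e \<in> U"
  shows "X e \<noteq> 0"
proof -
  have XL: "X \<in> L" using X by (simp add: topes_def)
  then obtain W where W: "W \<in> L" "\<forall>e\<in>U. W e \<noteq> 0" using full_support_covector by blast
  have "sv_comp X W \<in> L" using C XL W(1) by blast
  moreover have "sv_le U X (sv_comp X W)"
    unfolding sv_le_def sign_le_def sv_comp_def using covector_value[OF W(1)] W(2) by auto
  ultimately have "sv_comp X W = X"
    using X unfolding topes_def face_lattice_def by fastforce
  then have "sv_comp X W e = X e" by simp
  then show ?thesis using W(2) \<open>e \<in> U\<close> by (auto simp: sv_comp_def split: if_splits)
qed

lemma tope_family_shatters_iff: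
  assumes ne: "L \<noteq> {}" and B: "B \<subseteq> U"
  shows "shatters (tope_family U L) B \<longleftrightarrow> free_on L B"
proof
  assume sh: "shatters (tope_family U L) B"
  show "free_on L B"
    unfolding free_on_def
  proof (intro allI impI)
    fix P assume "P \<subseteq> B"
    then obtain X where X: "X \<in> topes U L" "pos_set U X \<inter> B = P"
      using sh unfolding shatters_def tope_family_def by blast
    have XL: "X \<in> L" using X(1) by (simp add: topes_def)
    have "X b = pattern_sign P b" if "b \<in> B" for b
      using that B X(2) covector_value[OF XL, of b] tope_full_support[OF X(1), of b]
      by (auto simp: pos_set_def pattern_sign_def)
    then show "\<exists>Y\<in>L. \<forall>b\<in>B. Y b = pattern_sign P b" using XL by blast
  qed
next
  assume free: "free_on L B"
  obtain W where W: "W \<in> L" "\<forall>e\<in>U. W e \<noteq> 0" using full_support_covector[OF ne] by blast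
  show "shatters (tope_family U L) B"
    unfolding shatters_def
  proof (intro allI impI)
    fix P assume P: "P \<subseteq> B"
    then obtain Y where Y: "Y \<in> L" "\<forall>b\<in>B. Y b = pattern_sign P b"
      using free unfolding free_on_def by blast
    let ?T = "sv_comp Y W"
    have "?T \<in> topes U L"
      using C[OF Y(1) W(1)] W(2) by (intro full_support_imp_tope) (auto simp: sv_comp_def)
    moreover have "?T b = pattern_sign P b" if "b \<in> B" for b
      using that Y(2) by (auto simp: sv_comp_def pattern_sign_def)
    then have "pos_set U ?T \<inter> B = P"
      using P B by (auto simp: pos_set_def pattern_sign_def split: if_splits)
    ultimately show "\<exists>S\<in>tope_family U L. S \<inter> B = P" unfolding tope_family_def by blast
  qed
qed

end

section \<open>Rank\<close>

context oriented_matroid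
begin

lemma sv_le_support: "sv_le U X Y \<Longrightarrow> e \<in> U \<Longrightarrow> X e \<noteq> 0 \<Longrightarrow> Y e \<noteq> 0"
  unfolding sv_le_def sign_le_def by auto

lemma sv_le_less_support:
  assumes "X \<in> L" "Y \<in> L" "sv_le U X Y" "X \<noteq> Y"
  shows "\<exists>e\<in>U. X e = 0 \<and> Y e \<noteq> 0"
proof -
  obtain e where "X e \<noteq> Y e" using assms(4) by (auto simp: fun_eq_iff)
  moreover from this have "e \<in> U"
    using covector_outside[OF assms(1)] covector_outside[OF assms(2)] by metis
  ultimately show ?thesis
    using assms(3) by (intro bexI[of _ e]) (auto simp: sv_le_def sign_le_def)
qed

lemma covector_chain_has_top:
  assumes "finite D" "D \<noteq> {}" "D \<subseteq> L"
    and tot: "\<forall>X\<in>D. \<forall>Y\<in>D. sv_le U X Y \<or> sv_le U Y X"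
  shows "\<exists>M\<in>D. \<forall>X\<in>D. sv_le U X M"
proof -
  define s where "s X = card {e \<in> U. X e \<noteq> 0}" for X :: "'a \<Rightarrow> int"
  have "Max (s ` D) \<in> s ` D" using assms(1,2) by simp
  then obtain M where M: "M \<in> D" "s M = Max (s ` D)" by auto
  have "sv_le U X M" if X: "X \<in> D" for X
  proof (rule ccontr)
    assume *: "\<not> sv_le U X M"
    then have le: "sv_le U M X" using tot M(1) X by blast
    have "X \<noteq> M" using * le by auto
    then obtain e where "e \<in> U" "M e = 0" "X e \<noteq> 0"
      using sv_le_less_support[of M X] le M(1) X assms(3) by blast
    then have "{e \<in> U. M e \<noteq> 0} \<subset> {e \<in> U. X e \<noteq> 0}"
      using sv_le_support[OF le] by blast
    then have "s M < s X" unfolding s_def using finite_ground by (intro psubset_card_mono) auto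
    moreover have "s X \<le> Max (s ` D)" using X assms(1) by simp
    ultimately show False using M(2) by simp
  qed
  then show ?thesis using M(1) by blast
qed

text \<open>
  Each covector of a chain is nonzero at an element \<open>e\<close> where its predecessors vanish.  In a
  composition of the chain from the bottom up, with arbitrary signs put in front of the factors,
  the value at \<open>e\<close> is therefore controlled by the sign of that single factor.  The bound on the
  support of \<open>Y\<close> keeps the next element still undecided during the induction.
\<close>

lemma covector_chain_free_set:
  assumes "finite D" "D \<subseteq> L" "\<forall>X\<in>D. \<forall>Y\<in>D. sv_le U X Y \<or> sv_le U Y X"
    and "M \<in> D" "\<forall>X\<in>D. sv_le U X M"
  shows "\<exists>B\<subseteq>{e \<in> U. M e \<noteq> 0}. card D = card B + 1 \<and>
    (\<forall>P. \<exists>Y\<in>L. (\<forall>e\<in>U. Y e \<noteq> 0 \<longrightarrow> M e \<noteq> 0) \<and> (\<forall>b\<in>B. Y b = pattern_sign P b))"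
  using assms
proof (induction "card D" arbitrary: D M)
  case 0
  then show ?case by simp
next
  case (Suc n)
  have M_cov: "M \<in> L" using Suc.prems by blast
  let ?D = "D - {M}"
  show ?case
  proof (cases "?D = {}")
    case True
    then have "D = {M}" using Suc.prems(4) by blast
    then show ?thesis using M_cov by (intro exI[of _ "{}"]) auto
  next
    case False
    have D': "finite ?D" "?D \<subseteq> L" "\<forall>X\<in>?D. \<forall>Y\<in>?D. sv_le U X Y \<or> sv_le U Y X"
      using Suc.prems by auto
    obtain N where N: "N \<in> ?D" "\<forall>X\<in>?D. sv_le U X N"
      using covector_chain_has_top[OF D'(1) False D'(2,3)] by blast
    have NM: "N \<in> L" "sv_le U N M" "N \<noteq> M" using N Suc.prems by auto
    have "n = card ?D" using Suc.hyps(2) Suc.prems(1,4) by simp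
    from Suc.hyps(1)[OF this D' N] obtain B where B: "B \<subseteq> {e \<in> U. N e \<noteq> 0}"
      "card ?D = card B + 1"
      "\<forall>P. \<exists>Y\<in>L. (\<forall>e\<in>U. Y e \<noteq> 0 \<longrightarrow> N e \<noteq> 0) \<and> (\<forall>b\<in>B. Y b = pattern_sign P b)"
      by blast
    obtain e where e: "e \<in> U" "N e = 0" "M e \<noteq> 0"
      using sv_le_less_support[OF NM(1) M_cov NM(2,3)] by blast
    have "finite B" using B(1) finite_ground by (auto intro: finite_subset)
    moreover have "e \<notin> B" using B(1) e(2) by blast
    ultimately have "card D = card (insert e B) + 1"
      using B(2) \<open>n = card ?D\<close> Suc.hyps(2) by simp
    moreover have "insert e B \<subseteq> {e \<in> U. M e \<noteq> 0}"
      using B(1) e sv_le_support[OF NM(2)] by blast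
    moreover have "\<exists>Y\<in>L. (\<forall>e\<in>U. Y e \<noteq> 0 \<longrightarrow> M e \<noteq> 0) \<and>
        (\<forall>b\<in>insert e B. Y b = pattern_sign P b)" for P
    proof -
      obtain Y where Y: "Y \<in> L" "\<forall>e\<in>U. Y e \<noteq> 0 \<longrightarrow> N e \<noteq> 0" "\<forall>b\<in>B. Y b = pattern_sign P b"
        using B(3) by blast
      have "\<exists>M'\<in>L. (\<forall>f. M' f \<noteq> 0 \<longrightarrow> M f \<noteq> 0) \<and> M' e = pattern_sign P e"
      proof (cases "M e = pattern_sign P e")
        case True
        then show ?thesis using M_cov by blast
      next
        case False
        then have "- M e = pattern_sign P e"
          using covector_value[OF M_cov, of e] e(3) by (auto simp: pattern_sign_def split: if_splits)
        then show ?thesis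
          using uminus_covector[OF M_cov] by (intro bexI[of _ "\<lambda>f. - M f"]) auto
      qed
      then obtain M' where M': "M' \<in> L" "\<forall>f. M' f \<noteq> 0 \<longrightarrow> M f \<noteq> 0" "M' e = pattern_sign P e"
        by blast
      have "Y e = 0" using Y(2) e by blast
      then have "sv_comp Y M' b = pattern_sign P b" if "b \<in> insert e B" for b
        using that Y(3) M'(3) by (auto simp: sv_comp_def pattern_sign_def)
      moreover have "M f \<noteq> 0" if "f \<in> U" "sv_comp Y M' f \<noteq> 0" for f
        using that Y(2) M'(2) sv_le_support[OF NM(2)] by (auto simp: sv_comp_def split: if_splits)
      ultimately show ?thesis using C[OF Y(1) M'(1)] by blast
    qed
    ultimately show ?thesis by blast
  qed
qed

text \<open>Conversely, composing dual covectors one after the other gives a strictly increasing chain.\<close>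

lemma free_set_covector_chain:
  assumes ne: "L \<noteq> {}" and B: "B \<subseteq> U" and free: "free_on L B"
  shows "\<exists>D\<subseteq>L. card D = card B + 1 \<and> (\<forall>X\<in>D. \<forall>Y\<in>D. sv_le U X Y \<or> sv_le U Y X)"
proof -
  have "\<exists>D\<subseteq>L. \<exists>M\<in>D. card D = card A + 1 \<and> (\<forall>X\<in>D. \<forall>Y\<in>D. sv_le U X Y \<or> sv_le U Y X) \<and>
      (\<forall>X\<in>D. sv_le U X M) \<and> (\<forall>b\<in>B. M b \<noteq> 0 \<longleftrightarrow> b \<in> A)" if "finite A" "A \<subseteq> B" for A
    using that
  proof (induction A)
    case empty
    show ?case
      using zero_covector[OF ne]
      by (intro exI[of _ "{\<lambda>_. 0}"] conjI bexI[of _ "\<lambda>_. 0"])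
        (auto simp: sv_le_def sign_le_def)
  next
    case (insert a A)
    then obtain D M where D: "D \<subseteq> L" "M \<in> D" "card D = card A + 1"
      "\<forall>X\<in>D. \<forall>Y\<in>D. sv_le U X Y \<or> sv_le U Y X" "\<forall>X\<in>D. sv_le U X M"
      "\<forall>b\<in>B. M b \<noteq> 0 \<longleftrightarrow> b \<in> A" by auto
    have M_cov: "M \<in> L" using D by blast
    have "a \<in> B" using insert.prems by blast
    obtain Y where Y: "Y \<in> L" "\<forall>b\<in>B. Y b = (if b = a then 1 else 0)"
      using free_on_dual_covector[OF free B \<open>a \<in> B\<close>] by blast
    let ?M = "sv_comp M Y"
    have M_cov': "?M \<in> L" using C M_cov Y(1) by blast
    have "sv_le U X ?M" if "X \<in> D" for X
      unfolding sv_le_def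
    proof
      fix e assume "e \<in> U"
      then have "sign_le (X e) (M e)" using D(5) that by (auto simp: sv_le_def)
      then show "sign_le (X e) (?M e)"
        using covector_value[OF Y(1), of e] by (auto simp: sign_le_def sv_comp_def)
    qed
    moreover have "sv_le U ?M ?M" by (auto simp: sv_le_def sign_le_def)
    ultimately have top: "\<forall>X\<in>insert ?M D. sv_le U X ?M" by blast
    have "?M a \<noteq> 0" using Y(2) \<open>a \<in> B\<close> by (auto simp: sv_comp_def)
    moreover have "X a = 0" if "X \<in> D" for X
      using that D(5,6) sv_le_support[of X M a] insert.hyps \<open>a \<in> B\<close> B by blast
    ultimately have "?M \<notin> D" by blast
    moreover have "finite D" using D(1) finite_covectors finite_subset by blast
    ultimately have "card (insert ?M D) = card (insert a A) + 1" using insert.hyps D(3) by simp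
    moreover have "\<forall>X\<in>insert ?M D. \<forall>Y\<in>insert ?M D. sv_le U X Y \<or> sv_le U Y X"
      using D(4) top by blast
    moreover have "\<forall>b\<in>B. ?M b \<noteq> 0 \<longleftrightarrow> b \<in> insert a A"
      using D(6) Y(2) by (auto simp: sv_comp_def)
    moreover have "insert ?M D \<subseteq> L" using D(1) M_cov' by blast
    ultimately show ?case using top by blast
  qed
  from this[OF finite_subset[OF B finite_ground] order_refl] show ?thesis by blast
qed

end

lemma om_rank_empty: "om_rank U {} = -1"
proof -
  have "pred_on.maxchain {None :: ('a \<Rightarrow> int) option} (face_le U) C \<longleftrightarrow> C = {None}" for C
    unfolding pred_on.maxchain_def pred_on.chain_def by auto
  then show ?thesis by (simp add: om_rank_def face_lattice_def)
qed

context oriented_matroid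
begin

text \<open>
  A longest chain of the face lattice has two elements more than a largest free set: the added
  maximum, and the bottom covector, which comes before the first gain in support.  The family
  \<open>F\<close> stands for both the topes and their completion.
\<close>

lemma om_rank_eq_vc_dim:
  assumes ne: "L \<noteq> {}" and F: "\<And>B. B \<subseteq> U \<Longrightarrow> shatters F B \<longleftrightarrow> free_on L B"
  shows "om_rank U L = int (vc_dim U F)"
proof -
  let ?A = "face_lattice L" and ?k = "vc_dim U F"
  let ?cards = "{card X | X. X \<subseteq> U \<and> shatters F X}"
  let ?chain = "pred_on.chain ?A (face_le U)"
  let ?maxchain = "pred_on.maxchain ?A (face_le U)"
  have finA: "finite ?A" by (simp add: face_lattice_def finite_covectors)
  have sub: "C \<subseteq> ?A" if "?chain C" for C using that by (simp add: pred_on.chain_def)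
  have fin_cards: "finite ?cards"
    by (rule finite_subset[of _ "card ` Pow U"]) (auto simp: finite_ground)
  have le_k: "card B \<le> ?k" if "B \<subseteq> U" "free_on L B" for B
    unfolding vc_dim_def using that F fin_cards by (intro Max_ge) auto
  have upper: "card C \<le> ?k + 2" if ch: "?chain C" for C
  proof -
    define D where "D = {X. Some X \<in> C}"
    have DL: "D \<subseteq> L" using sub[OF ch] by (auto simp: D_def face_lattice_def)
    then have finD: "finite D" using finite_covectors finite_subset by blast
    have tot: "\<forall>X\<in>D. \<forall>Y\<in>D. sv_le U X Y \<or> sv_le U Y X"
    proof (intro ballI)
      fix X Y assume "X \<in> D" "Y \<in> D"
      then have "X = Y \<or> face_le U (Some X) (Some Y) \<or> face_le U (Some Y) (Some X)"
        using ch unfolding pred_on.chain_def D_def by blast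
      then show "sv_le U X Y \<or> sv_le U Y X" by (auto simp: sv_le_def sign_le_def)
    qed
    have "card D \<le> ?k + 1"
    proof (cases "D = {}")
      case False
      then obtain M where M: "M \<in> D" "\<forall>X\<in>D. sv_le U X M"
        using covector_chain_has_top[OF finD _ DL tot] by blast
      obtain B where B: "B \<subseteq> {e \<in> U. M e \<noteq> 0}" "card D = card B + 1"
        "\<forall>P. \<exists>Y\<in>L. (\<forall>e\<in>U. Y e \<noteq> 0 \<longrightarrow> M e \<noteq> 0) \<and> (\<forall>b\<in>B. Y b = pattern_sign P b)"
        using covector_chain_free_set[OF finD DL tot M] by blast
      then have "free_on L B" "B \<subseteq> U" unfolding free_on_def by blast+
      then show ?thesis using le_k B(2) by simp
    qed simp
    moreover have "C \<subseteq> insert None (Some ` D)"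
    proof
      fix x assume "x \<in> C"
      then show "x \<in> insert None (Some ` D)" by (cases x) (auto simp: D_def)
    qed
    then have "card C \<le> card (insert None (Some ` D))" using finD by (intro card_mono) auto
    ultimately show ?thesis using finD by (simp add: card_image)
  qed
  have lower: "\<exists>C. ?chain C \<and> card C = ?k + 2"
  proof -
    have "free_on L {}" using ne by (auto simp: free_on_def)
    then have "shatters F {}" using F[of "{}"] by simp
    then have "?cards \<noteq> {}" by blast
    then have "?k \<in> ?cards" unfolding vc_dim_def using fin_cards by (intro Max_in) auto
    then obtain B where B: "B \<subseteq> U" "free_on L B" "card B = ?k" using F by auto
    obtain D where D: "D \<subseteq> L" "card D = card B + 1"
      "\<forall>X\<in>D. \<forall>Y\<in>D. sv_le U X Y \<or> sv_le U Y X"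
      using free_set_covector_chain[OF ne B(1,2)] by blast
    have "?chain (insert None (Some ` D))"
      using D(1,3) unfolding pred_on.chain_def face_lattice_def by auto
    moreover have "card (insert None (Some ` D)) = ?k + 2"
      using D(1,2) B(3) finite_subset[OF D(1) finite_covectors] by (simp add: card_image)
    ultimately show ?thesis by blast
  qed
  then obtain C where C: "?chain C" "card C = ?k + 2" by blast
  have "?maxchain C"
    unfolding pred_on.maxchain_def
  proof (intro conjI notI)
    assume "\<exists>S. ?chain S \<and> C \<subset> S"
    then obtain S where S: "?chain S" "C \<subset> S" by blast
    then have "card C < card S" using sub finA finite_subset psubset_card_mono by metis
    then show False using upper[OF S(1)] C(2) by simp
  qed (rule C(1))
  then have "Max {int (card C) - 1 | C. ?maxchain C} = int ?k + 1"
  proof (intro Max_eqI)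
    show "finite {int (card C) - 1 | C. ?maxchain C}"
    proof (rule finite_subset)
      show "{int (card C) - 1 | C. ?maxchain C} \<subseteq> (\<lambda>C. int (card C) - 1) ` Pow ?A"
        using sub by (auto simp: pred_on.maxchain_def)
    qed (simp add: finA)
    show "y \<le> int ?k + 1" if "y \<in> {int (card C) - 1 | C. ?maxchain C}" for y
      using that upper by (force simp: pred_on.maxchain_def)
    show "int ?k + 1 \<in> {int (card C) - 1 | C. ?maxchain C}"
      using \<open>?maxchain C\<close> C(2) by force
  qed
  then show ?thesis by (simp add: om_rank_def)
qed

end

section \<open>Ample completion\<close>

theorem theorem2:
  fixes U :: "'a set" and L :: "('a \<Rightarrow> int) set" and d :: nat
  assumes "simple_oriented_matroid U L"
    and "om_rank U L = int d"
  shows "vc_dim U (tope_family U L) = d \<and>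
    (\<exists>S. S \<noteq> {} \<and> ample U S \<and> vc_dim U S = d \<and> tope_family U L \<subseteq> S)"
proof -
  interpret simple_oriented_matroid U L by (rule assms(1))
  have ne: "L \<noteq> {}" using assms(2) om_rank_empty[of U] by auto
  obtain r :: "'a \<Rightarrow> nat" where r: "inj_on r U"
    using finite_imp_inj_to_nat_seg[OF finite_ground] by blast
  let ?S = "generic_translation U L r"
  have "vc_dim U (tope_family U L) = d"
    using om_rank_eq_vc_dim[OF ne tope_family_shatters_iff[OF ne]] assms(2) by simp
  moreover have "vc_dim U ?S = d"
    using om_rank_eq_vc_dim[OF ne generic_translation_shatters_iff[OF ne r]] assms(2) by simp
  moreover have "tope_family U L \<subseteq> ?S"
    using pos_set_in_generic_translation by (auto simp: tope_family_def topes_def)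
  moreover have "?S \<noteq> {}" using pos_set_in_generic_translation ne by blast
  ultimately show ?thesis using ample_generic_translation[OF ne r] by blast
qed

end
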